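(* Let $m,g,A,C,R,\mu>0$ and $0<\epsilon<R$. For a Jellet value $J\in\mathbb R$ consider the relative equilibria $\theta_0\in[0,\pi]$ of the reduced tippe top system, with vertical states, intermediate states, (linear) stability, spins $n_0,n_\pi$ and the number $x_b$ as defined in the context. Set $$n_1=\sqrt{\frac{mg\epsilon}{C[\frac AC-(1-\frac\epsilon R)]}}\Big(1-\frac\epsilon R\Big)\ \text{ if } \tfrac AC>1-\tfrac\epsilon R,\qquad n_2=\sqrt{\frac{mg\epsilon}{C[(1+\frac\epsilon R)-\frac AC]}}\Big(1+\frac\epsilon R\Big)\ \text{ if } \tfrac AC<1+\tfrac\epsilon R.$$ Group I: $A/C-1<-\epsilon/R$. - The vertical state $\theta=0$ is stable for every $J$. - The vertical state $\theta=\pi$ is stable if $|n_\pi|>n_2$ and unstable otherwise. - Intermediate states exist (for suitable $J$) only for $\theta>\theta_c=\arccos\big(\frac{\epsilon/R}{1-A/C}\big)$. Ia: if $x_b<-1$, all intermediate states are unstable. Ib: if $x_b>-1$, put $\theta_b=\arccos x_b$; there is a bifurcation of intermediate states at $\theta_b$: intermediate states with $\theta>\theta_b$ are stable and those with $\theta<\theta_b$ are unstable. Group II: $-\epsilon/R<A/C-1<\epsilon/R$. - The vertical state $\theta=0$ is stable if $|n_0|<n_1$ and unstable if $|n_0|>n_1$. - The vertical state $\theta=\pi$ is stable if $|n_\pi|>n_2$ and unstable otherwise. - For every $\theta\in(0,\pi)$ there is a value of $J$ for which $\theta$ is an intermediate state. IIa: if $A/C-1<-(\epsilon/R)^2$ and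 $|x_b|<1$, there is a bifurcation of intermediate states at $\theta_b=\arccos x_b$: intermediate states with $\theta>\theta_b$ are stable and those with $\theta<\theta_b$ are unstable. IIb: if either $A/C-1\ge-(\epsilon/R)^2$, or $A/C-1<-(\epsilon/R)^2$ and $x_b>1$, all intermediate states are stable. IIc: if $A/C-1<-(\epsilon/R)^2$ and $x_b<-1$, all intermediate states are unstable. Group III: $A/C-1>\epsilon/R$. - The vertical state $\theta=0$ is stable if $|n_0|<n_1$ and unstable if $|n_0|>n_1$. - The vertical state $\theta=\pi$ is unstable for every $J$. - There are no intermediate states with $\theta\in(\theta_c,\pi)$, where $\cos\theta_c=\frac{\epsilon/R}{1-A/C}$; there is no bifurcation of intermediate states, and all intermediate states are stable. In Group II, if $|n_0|>\max\big(n_1,\,n_2\frac{R+\epsilon}{R-\epsilon}\big)$, then tipping from $\theta=0$ to $\theta=\pi$ is possible, in the sense that $\theta=0$ is unstable and $\theta=\pi$ is stable for the corresponding value of $J$.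
   Context: The tippe top is modelled as a sphere of radius $R$ and mass $m$ whose centre of mass is at distance $\epsilon$ from its geometric centre. It is axially symmetric with principal moments of inertia $A,A,C$ ($C$ about the symmetry axis), and it moves on a horizontal plane with viscous sliding friction of coefficient $\mu$. Here $\theta$ is the angle between the vertical and the symmetry axis. Neglecting translational effects in the friction, Routhian reduction with respect to the Jellet constant of motion $J$ gives the following reduced system in $(\theta,\bar\varphi)$. Put $D(\theta)=R^2A\sin^2\theta+C(R\cos\theta-\epsilon)^2$, $T_{\theta\theta}=\epsilon^2m\sin^2\theta+A$, $T_{\bar\varphi\bar\varphi}=AC\sin^2\theta/D(\theta)$, $$\tau(\theta)=\frac{J}{R^2+\epsilon^2}\,\frac{R\epsilon A\sin^2\theta+C(R+\epsilon\cos\theta)(R\cos\theta-\epsilon)}{D(\theta)},\qquad W(\theta)=\frac{J^2}{2D(\theta)}-mg\epsilon\cos\theta.$$ The equations of motion are the Lagrange equations of $\mathcal R=\frac12T_{\theta\theta}\dot\theta^2+\frac12T_{\bar\varphi\bar\varphi}\dot{\bar\varphi}^2+\tau\dot{\bar\varphi}-W$ with generalized forces $-\mu R_n'(R-\epsilon\cos\theta)^2\dot\theta$ in $\theta$ and $-\mu R_n'\sin^2\theta\,\dot{\bar\varphi}$ in $\bar\varphi$, where the normal reaction $R_n'$ is a function of $(\theta,\dot\theta,\dot{\bar\varphi})$ equal to $mg$ at every relative equilibrium. Relative equilibria for the value $J$: $\dot\theta=\dot{\bar\varphi}=0$ and $W'(\theta)=0$. These are the vertical states $\theta=0$, $\theta=\pi$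 (which exist for every $J$), and the intermediate states, i.e. those $\theta\in(0,\pi)$ with $f(J^2,\cos\theta)=0$, where $$f(J^2,\cos\theta)=\frac{J^2}{mgCR^2\epsilon}\Big(\big(\tfrac AC-1\big)\cos\theta+\tfrac\epsilon R\Big)-\Big(\tfrac AC\sin^2\theta+\big(\cos\theta-\tfrac\epsilon R\big)^2\Big)^2.$$ A bifurcation point of intermediate states is a point with $f=0$ and $\partial_2f=0$, where $\partial_2$ is the partial derivative with respect to the second argument $\cos\theta$. Stability: a relative equilibrium $\theta_0$ is stable if all three roots of $$\lambda^3+\mu mg\Big(\frac{(R-\epsilon\cos\theta_0)^2}{T_{\theta\theta}}+\frac{\sin^2\theta_0}{T_{\bar\varphi\bar\varphi}}\Big)\lambda^2+\Big(\frac{(\mu mg(R-\epsilon\cos\theta_0)\sin\theta_0)^2+\tau'^2}{T_{\theta\theta}T_{\bar\varphi\bar\varphi}}+\frac{W''}{T_{\theta\theta}}\Big)\lambda+\frac{\mu mg\sin^2\theta_0\,W''}{T_{\theta\theta}T_{\bar\varphi\bar\varphi}}$$ (all functions evaluated at $\theta_0$; coefficients extended continuously when $\sin\theta_0=0$) have negative real part, and unstable otherwise. The zeros of this cubic are the eigenvalues of the linearized reduced equations other than the zero eigenvalue coming from the translational symmetry in $\bar\varphi$. Spins at the vertical states for Jellet value $J$: $n_0=\frac{J}{C(R-\epsilon)}$ and $n_\pi=-\frac{J}{C(R+\epsilon)}$. When $1-A/C-(\epsilon/R)^2>0$ put $$x_b=\frac{\epsilon/R}{1-A/C}-\frac{1}{1-A/C}\frac{\sqrt3}{3}\sqrt{A/C}\sqrt{1-A/C-(\epsilon/R)^2}.$$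 This number is defined for all parameters in Group I, since there $1-A/C-(\epsilon/R)^2>0$. *)

theory Defs
  imports "HOL-Analysis.Analysis"
begin

text \<open>
  Parameters throughout: mass \<open>m\<close>, gravity \<open>g\<close>, principal moments of inertia \<open>A, A, C\<close>, radius \<open>R\<close>,
  eccentricity \<open>\<epsilon>\<close> of the centre of mass, friction coefficient \<open>\<mu>\<close>, Jellet constant \<open>J\<close>.
\<close>

definition D_fun :: "real \<Rightarrow> real \<Rightarrow> real \<Rightarrow> real \<Rightarrow> real \<Rightarrow> real" where
  "D_fun A C R \<epsilon> \<theta> = R\<^sup>2 * A * (sin \<theta>)\<^sup>2 + C * (R * cos \<theta> - \<epsilon>)\<^sup>2"

definition T_theta :: "real \<Rightarrow> real \<Rightarrow> real \<Rightarrow> real \<Rightarrow> real" where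
  "T_theta m A \<epsilon> \<theta> = \<epsilon>\<^sup>2 * m * (sin \<theta>)\<^sup>2 + A"

definition T_phi :: "real \<Rightarrow> real \<Rightarrow> real \<Rightarrow> real \<Rightarrow> real \<Rightarrow> real" where
  "T_phi A C R \<epsilon> \<theta> = A * C * (sin \<theta>)\<^sup>2 / D_fun A C R \<epsilon> \<theta>"

definition tau :: "real \<Rightarrow> real \<Rightarrow> real \<Rightarrow> real \<Rightarrow> real \<Rightarrow> real \<Rightarrow> real" where
  "tau A C R \<epsilon> J \<theta> =
     J / (R\<^sup>2 + \<epsilon>\<^sup>2) *
     ((R * \<epsilon> * A * (sin \<theta>)\<^sup>2 + C * (R + \<epsilon> * cos \<theta>) * (R * cos \<theta> - \<epsilon>)) / D_fun A C R \<epsilon> \<theta>)"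

definition W_pot :: "real \<Rightarrow> real \<Rightarrow> real \<Rightarrow> real \<Rightarrow> real \<Rightarrow> real \<Rightarrow> real \<Rightarrow> real \<Rightarrow> real" where
  "W_pot m g A C R \<epsilon> J \<theta> = J\<^sup>2 / (2 * D_fun A C R \<epsilon> \<theta>) - m * g * \<epsilon> * cos \<theta>"

text \<open>
  A relative equilibrium has vanishing velocities and arbitrary ignorable angle, so it is
  identified with its nutation angle \<open>\<theta>\<close>.
\<close>

definition relative_equilibrium ::
  "real \<Rightarrow> real \<Rightarrow> real \<Rightarrow> real \<Rightarrow> real \<Rightarrow> real \<Rightarrow> real \<Rightarrow> real \<Rightarrow> bool" where
  "relative_equilibrium m g A C R \<epsilon> J \<theta> \<longleftrightarrow>
     0 \<le> \<theta> \<and> \<theta> \<le> pi \<and> deriv (W_pot m g A C R \<epsilon> J) \<theta> = 0"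

text \<open>
  The function \<open>f(J\<^sup>2, cos \<theta>)\<close>; the arguments are \<open>j = J\<^sup>2\<close> and \<open>x = cos \<theta>\<close>, with \<open>sin\<^sup>2 \<theta>\<close>
  written as \<open>1 - x\<^sup>2\<close>.
\<close>

definition f_int ::
  "real \<Rightarrow> real \<Rightarrow> real \<Rightarrow> real \<Rightarrow> real \<Rightarrow> real \<Rightarrow> real \<Rightarrow> real \<Rightarrow> real" where
  "f_int m g A C R \<epsilon> j x =
     j / (m * g * C * R\<^sup>2 * \<epsilon>) * ((A / C - 1) * x + \<epsilon> / R)
     - (A / C * (1 - x\<^sup>2) + (x - \<epsilon> / R)\<^sup>2)\<^sup>2"

definition intermediate_state ::
  "real \<Rightarrow> real \<Rightarrow> real \<Rightarrow> real \<Rightarrow> real \<Rightarrow> real \<Rightarrow> real \<Rightarrow> real \<Rightarrow> bool" where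
  "intermediate_state m g A C R \<epsilon> J \<theta> \<longleftrightarrow>
     0 < \<theta> \<and> \<theta> < pi \<and> f_int m g A C R \<epsilon> (J\<^sup>2) (cos \<theta>) = 0"

definition bifurcation_point ::
  "real \<Rightarrow> real \<Rightarrow> real \<Rightarrow> real \<Rightarrow> real \<Rightarrow> real \<Rightarrow> real \<Rightarrow> real \<Rightarrow> bool" where
  "bifurcation_point m g A C R \<epsilon> J \<theta> \<longleftrightarrow>
     intermediate_state m g A C R \<epsilon> J \<theta> \<and>
     deriv (f_int m g A C R \<epsilon> (J\<^sup>2)) (cos \<theta>) = 0"

lemma relative_equilibrium_iff:
  fixes m g A C R \<epsilon> J \<theta> :: real
  assumes pos: "m > 0" "g > 0" "A > 0" "C > 0" "0 < \<epsilon>" "\<epsilon> < R" and th: "0 \<le> \<theta>" "\<theta> \<le> pi"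
  shows "relative_equilibrium m g A C R \<epsilon> J \<theta> \<longleftrightarrow>
           \<theta> = 0 \<or> \<theta> = pi \<or> intermediate_state m g A C R \<epsilon> J \<theta>"
proof -
  define x where "x = cos \<theta>"
  define P where "P = (A / C - 1) * x + \<epsilon> / R"
  define Q where "Q = A / C * (1 - x\<^sup>2) + (x - \<epsilon> / R)\<^sup>2"
  have R: "R > 0" using pos by simp
  have s2: "(sin \<theta>)\<^sup>2 = 1 - x\<^sup>2" unfolding x_def by (simp add: sin_squared_eq)
  have D: "D_fun A C R \<epsilon> \<theta> = R\<^sup>2 * C * Q"
    unfolding D_fun_def Q_def s2 x_def[symmetric] using R pos
    by (simp add: field_simps power2_eq_square)
  have Dpos: "D_fun A C R \<epsilon> \<theta> > 0"
  proof (cases "sin \<theta> = 0")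
    case True
    then have "\<bar>cos \<theta>\<bar> = 1" using sin_zero_abs_cos_one by blast
    then have "R * cos \<theta> - \<epsilon> \<noteq> 0" using pos by (auto simp: abs_if split: if_splits)
    then show ?thesis using pos True by (simp add: D_fun_def)
  next
    case False
    then show ?thesis unfolding D_fun_def using pos R by (intro add_pos_nonneg mult_pos_pos) auto
  qed
  then have Q: "Q > 0" unfolding D using zero_less_mult_pos[of "R\<^sup>2 * C" Q] R pos by simp
  have "(D_fun A C R \<epsilon> has_real_derivative
      2 * R\<^sup>2 * A * sin \<theta> * cos \<theta> - 2 * C * R * sin \<theta> * (R * cos \<theta> - \<epsilon>)) (at \<theta>)"
    unfolding D_fun_def[abs_def] by (auto intro!: derivative_eq_intros)
  note dD = this
  have "(W_pot m g A C R \<epsilon> J has_real_derivative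
      m * g * \<epsilon> * sin \<theta> - J\<^sup>2 * (2 * R\<^sup>2 * A * sin \<theta> * cos \<theta> - 2 * C * R * sin \<theta> * (R * cos \<theta> - \<epsilon>))
        / (2 * (D_fun A C R \<epsilon> \<theta>)\<^sup>2)) (at \<theta>)" (is "(_ has_real_derivative ?w) _")
  proof -
    have c: "((\<lambda>t. m * g * \<epsilon> * cos t) has_real_derivative - (m * g * \<epsilon> * sin \<theta>)) (at \<theta>)"
      by (auto intro!: derivative_eq_intros)
    have nz: "D_fun A C R \<epsilon> \<theta> \<noteq> 0" using Dpos by simp
    have "((\<lambda>t. J\<^sup>2 / 2 * inverse (D_fun A C R \<epsilon> t) - m * g * \<epsilon> * cos t) has_real_derivative ?w) (at \<theta>)"
    proof (rule DERIV_cong[OF DERIV_diff[OF DERIV_cmult[OF DERIV_inverse'[OF dD nz]] c]])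
      have "j / 2 * - (inverse d * d' * inverse d) - - e = e - j * d' / (2 * d\<^sup>2)" if "d \<noteq> 0"
        for j d d' e :: real
        using that by (simp add: field_simps power2_eq_square)
      from this[OF nz]
      show "J\<^sup>2 / 2 * - (inverse (D_fun A C R \<epsilon> \<theta>)
          * (2 * R\<^sup>2 * A * sin \<theta> * cos \<theta> - 2 * C * R * sin \<theta> * (R * cos \<theta> - \<epsilon>))
          * inverse (D_fun A C R \<epsilon> \<theta>)) - - (m * g * \<epsilon> * sin \<theta>) = ?w" .
    qed
    moreover have "W_pot m g A C R \<epsilon> J = (\<lambda>t. J\<^sup>2 / 2 * inverse (D_fun A C R \<epsilon> t) - m * g * \<epsilon> * cos t)"
      by (simp add: W_pot_def fun_eq_iff inverse_eq_divide)
    ultimately show ?thesis by simp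
  qed
  then have "deriv (W_pot m g A C R \<epsilon> J) \<theta> =
      m * g * \<epsilon> * sin \<theta> - J\<^sup>2 * (2 * R\<^sup>2 * A * sin \<theta> * x - 2 * C * R * sin \<theta> * (R * x - \<epsilon>))
        / (2 * (D_fun A C R \<epsilon> \<theta>)\<^sup>2)"
    unfolding x_def by (rule DERIV_imp_deriv)
  also have "2 * R\<^sup>2 * A * sin \<theta> * x - 2 * C * R * sin \<theta> * (R * x - \<epsilon>) = 2 * R\<^sup>2 * C * sin \<theta> * P"
    unfolding P_def using R pos by (simp add: field_simps power2_eq_square)
  also have "m * g * \<epsilon> * sin \<theta> - J\<^sup>2 * (2 * R\<^sup>2 * C * sin \<theta> * P) / (2 * (D_fun A C R \<epsilon> \<theta>)\<^sup>2)
      = - (m * g * \<epsilon> * sin \<theta> * f_int m g A C R \<epsilon> (J\<^sup>2) x / Q\<^sup>2)"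
    unfolding D f_int_def P_def[symmetric] Q_def[symmetric] using R pos Q
    by (simp add: field_simps power2_eq_square)
  finally have "deriv (W_pot m g A C R \<epsilon> J) \<theta> = 0 \<longleftrightarrow> sin \<theta> = 0 \<or> f_int m g A C R \<epsilon> (J\<^sup>2) x = 0"
    using Q pos by simp
  moreover have "sin \<theta> = 0 \<longleftrightarrow> \<theta> = 0 \<or> \<theta> = pi"
    using th sin_gt_zero[of \<theta>] by (metis less_eq_real_def less_irrefl sin_pi sin_zero)
  ultimately show ?thesis
    using th unfolding relative_equilibrium_def intermediate_state_def x_def by auto
qed

text \<open>
  The coefficients of the characteristic cubic contain \<open>0/0\<close> when \<open>sin \<theta> = 0\<close>, where they are
  understood as their continuous extensions.
\<close>

definition cont_ext :: "(real \<Rightarrow> real) \<Rightarrow> real \<Rightarrow> real" where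
  "cont_ext h \<theta> = (if sin \<theta> = 0 then Lim (at \<theta>) h else h \<theta>)"

definition cubic_a2 ::
  "real \<Rightarrow> real \<Rightarrow> real \<Rightarrow> real \<Rightarrow> real \<Rightarrow> real \<Rightarrow> real \<Rightarrow> real \<Rightarrow> real" where
  "cubic_a2 m g A C R \<epsilon> \<mu> \<theta> =
     \<mu> * m * g * ((R - \<epsilon> * cos \<theta>)\<^sup>2 / T_theta m A \<epsilon> \<theta> + (sin \<theta>)\<^sup>2 / T_phi A C R \<epsilon> \<theta>)"

definition cubic_a1 ::
  "real \<Rightarrow> real \<Rightarrow> real \<Rightarrow> real \<Rightarrow> real \<Rightarrow> real \<Rightarrow> real \<Rightarrow> real \<Rightarrow> real \<Rightarrow> real" where
  "cubic_a1 m g A C R \<epsilon> \<mu> J \<theta> =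
     ((\<mu> * m * g * (R - \<epsilon> * cos \<theta>) * sin \<theta>)\<^sup>2 + (deriv (tau A C R \<epsilon> J) \<theta>)\<^sup>2)
       / (T_theta m A \<epsilon> \<theta> * T_phi A C R \<epsilon> \<theta>)
     + deriv (deriv (W_pot m g A C R \<epsilon> J)) \<theta> / T_theta m A \<epsilon> \<theta>"

definition cubic_a0 ::
  "real \<Rightarrow> real \<Rightarrow> real \<Rightarrow> real \<Rightarrow> real \<Rightarrow> real \<Rightarrow> real \<Rightarrow> real \<Rightarrow> real \<Rightarrow> real" where
  "cubic_a0 m g A C R \<epsilon> \<mu> J \<theta> =
     \<mu> * m * g * (sin \<theta>)\<^sup>2 * deriv (deriv (W_pot m g A C R \<epsilon> J)) \<theta>
       / (T_theta m A \<epsilon> \<theta> * T_phi A C R \<epsilon> \<theta>)"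

definition char_cubic ::
  "real \<Rightarrow> real \<Rightarrow> real \<Rightarrow> real \<Rightarrow> real \<Rightarrow> real \<Rightarrow> real \<Rightarrow> real \<Rightarrow> real \<Rightarrow> complex \<Rightarrow> complex" where
  "char_cubic m g A C R \<epsilon> \<mu> J \<theta> z =
     z ^ 3
     + of_real (cont_ext (cubic_a2 m g A C R \<epsilon> \<mu>) \<theta>) * z\<^sup>2
     + of_real (cont_ext (cubic_a1 m g A C R \<epsilon> \<mu> J) \<theta>) * z
     + of_real (cont_ext (cubic_a0 m g A C R \<epsilon> \<mu> J) \<theta>)"

definition stable_state ::
  "real \<Rightarrow> real \<Rightarrow> real \<Rightarrow> real \<Rightarrow> real \<Rightarrow> real \<Rightarrow> real \<Rightarrow> real \<Rightarrow> real \<Rightarrow> bool" where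
  "stable_state m g A C R \<epsilon> \<mu> J \<theta> \<longleftrightarrow>
     relative_equilibrium m g A C R \<epsilon> J \<theta> \<and>
     (\<forall>z. char_cubic m g A C R \<epsilon> \<mu> J \<theta> z = 0 \<longrightarrow> Re z < 0)"

definition unstable_state ::
  "real \<Rightarrow> real \<Rightarrow> real \<Rightarrow> real \<Rightarrow> real \<Rightarrow> real \<Rightarrow> real \<Rightarrow> real \<Rightarrow> real \<Rightarrow> bool" where
  "unstable_state m g A C R \<epsilon> \<mu> J \<theta> \<longleftrightarrow>
     relative_equilibrium m g A C R \<epsilon> J \<theta> \<and> \<not> stable_state m g A C R \<epsilon> \<mu> J \<theta>"

definition spin_0 :: "real \<Rightarrow> real \<Rightarrow> real \<Rightarrow> real \<Rightarrow> real" where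
  "spin_0 C R \<epsilon> J = J / (C * (R - \<epsilon>))"

definition spin_pi :: "real \<Rightarrow> real \<Rightarrow> real \<Rightarrow> real \<Rightarrow> real" where
  "spin_pi C R \<epsilon> J = - (J / (C * (R + \<epsilon>)))"

text \<open>Meaningful only when \<open>1 - A/C - (\<epsilon>/R)\<^sup>2 > 0\<close>.\<close>

definition x_bif :: "real \<Rightarrow> real \<Rightarrow> real \<Rightarrow> real \<Rightarrow> real" where
  "x_bif A C R \<epsilon> =
     (\<epsilon> / R) / (1 - A / C)
     - 1 / (1 - A / C) * (sqrt 3 / 3) * sqrt (A / C) * sqrt (1 - A / C - (\<epsilon> / R)\<^sup>2)"

end

theory Submission
  imports Defs
begin

text \<open>
  Write \<open>x = cos \<theta>\<close>, \<open>D = R\<^sup>2 C Q(x)\<close> and \<open>P(x) = (A/C - 1) x + \<epsilon>/R\<close>. The potential is a function of \<open>x\<close>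
  with derivative \<open>m g \<epsilon> f / Q\<^sup>2\<close>, and after the continuous extension the coefficients of the cubic
  satisfy the Routh--Hurwitz inequalities exactly when \<open>W'' > 0\<close>. At a vertical state \<open>W''\<close> has the
  sign of \<open>-x f\<close>; this yields the spin thresholds. At an intermediate state \<open>J\<^sup>2 / (m g C R\<^sup>2 \<epsilon>) = Q\<^sup>2 / P\<close>,
  so \<open>P > 0\<close>, and \<open>W''\<close> has the sign of
  \<open>4 P\<^sup>2 - (1 - A/C) Q = 3 P\<^sup>2 - (A/C) (1 - A/C - (\<epsilon>/R)\<^sup>2)\<close>. The number \<open>x_b\<close> is the zero of the latter
  at which \<open>P > 0\<close>.
\<close>

section \<open>Real cubics, continuous extension, and squared spin thresholds\<close>

lemma cubic_roots_Re_neg: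
  fixes a b c :: real
  assumes "a > 0" "c > 0" "a * b > c"
    and root: "z ^ 3 + of_real a * z\<^sup>2 + of_real b * z + of_real c = 0"
  shows "Re z < 0"
proof (rule ccontr)
  assume "\<not> Re z < 0"
  define x where "x = Re z"
  define y where "y = Im z"
  have x: "x \<ge> 0" using \<open>\<not> Re z < 0\<close> by (simp add: x_def)
  have "0 < a * b" using assms by linarith
  then have b: "b > 0" using \<open>a > 0\<close> by (simp add: zero_less_mult_iff)
  have z: "z = Complex x y" by (simp add: x_def y_def)
  have re: "x ^ 3 - 3 * x * y\<^sup>2 + a * (x\<^sup>2 - y\<^sup>2) + b * x + c = 0"
    using arg_cong[OF root, of Re] unfolding z
    by (simp add: power2_eq_square power3_eq_cube algebra_simps)
  have im: "y * (3 * x\<^sup>2 - y\<^sup>2 + 2 * a * x + b) = 0"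
    using arg_cong[OF root, of Im] unfolding z
    by (simp add: power2_eq_square power3_eq_cube algebra_simps)
  have xs: "x ^ 3 \<ge> 0" "a * x\<^sup>2 \<ge> 0" "b * x \<ge> 0" "a\<^sup>2 * x \<ge> 0" using x assms b by auto
  show False
  proof (cases "y = 0")
    case True
    then show False using re xs \<open>c > 0\<close> by simp
  next
    \<comment> \<open>For a non-real root the imaginary part determines \<open>y\<^sup>2\<close>.
      Eliminating it from the real part leaves, up to sign, a sum whose terms are nonnegative for
      \<open>x \<ge> 0\<close> plus the Hurwitz difference \<open>a * b - c > 0\<close>.\<close>
    case False
    then have y2: "y\<^sup>2 = 3 * x\<^sup>2 + 2 * a * x + b" using im by simp
    have "8 * x ^ 3 + 8 * (a * x\<^sup>2) + 2 * (b * x) + 2 * (a\<^sup>2 * x) + (a * b - c) = 0"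
      using re unfolding y2 by (simp add: power2_eq_square power3_eq_cube algebra_simps)
    then show False using xs \<open>a * b > c\<close> by linarith
  qed
qed

text \<open>Intermediate value theorem on \<open>{0..M}\<close>: the value at 0 is \<open>c\<close>,
  and the cubic term dominates at \<open>M\<close> because \<open>M ^ 3\<close> is at least
  \<open>M\<^sup>2\<close> times the sum of the absolute values of the coefficients and
  \<open>M\<^sup>2 \<ge> M \<ge> 1\<close>. This is the instability direction: a constant term that
  is not positive already excludes stability, whatever the other coefficients are.\<close>

lemma cubic_nonneg_root:
  fixes a b c :: real
  assumes "c \<le> 0"
  shows "\<exists>t\<ge>0. t ^ 3 + a * t\<^sup>2 + b * t + c = 0"
proof -
  define p where "p t = t ^ 3 + a * t\<^sup>2 + b * t + c" for t
  define M where "M = 1 + \<bar>a\<bar> + \<bar>b\<bar> + \<bar>c\<bar>"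
  have M: "M \<ge> 1" by (simp add: M_def)
  have M2: "M \<le> M\<^sup>2" "1 \<le> M\<^sup>2" using M by (auto simp: power2_eq_square intro: mult_right_mono[of 1 M M, simplified] order_trans[OF M])
  have "\<bar>a\<bar> * M\<^sup>2 + \<bar>b\<bar> * M\<^sup>2 + \<bar>c\<bar> * M\<^sup>2 \<le> M ^ 3"
    using M2 by (simp add: M_def power3_eq_cube power2_eq_square algebra_simps)
  moreover have "- (\<bar>a\<bar> * M\<^sup>2) \<le> a * M\<^sup>2"
    by (metis abs_ge_minus_self abs_mult abs_power2 minus_le_iff)
  moreover have "- (\<bar>b\<bar> * M\<^sup>2) \<le> b * M"
  proof -
    have "- (b * M) \<le> \<bar>b\<bar> * M" using M by (simp add: abs_if)
    also have "\<dots> \<le> \<bar>b\<bar> * M\<^sup>2" using M2 by (intro mult_left_mono) auto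
    finally show ?thesis by simp
  qed
  moreover have "- (\<bar>c\<bar> * M\<^sup>2) \<le> c"
  proof -
    have "- c \<le> \<bar>c\<bar> * 1" by simp
    also have "\<dots> \<le> \<bar>c\<bar> * M\<^sup>2" using M2 by (intro mult_left_mono) auto
    finally show ?thesis by simp
  qed
  ultimately have "p M \<ge> 0" unfolding p_def by linarith
  moreover have "p 0 \<le> 0" using assms by (simp add: p_def)
  moreover have "continuous_on {0..M} p" unfolding p_def by (intro continuous_intros)
  ultimately obtain t where "0 \<le> t" "p t = 0" using IVT'[of p 0 0 M] M by auto
  then show ?thesis unfolding p_def by blast
qed

lemma cont_ext_eqI:
  fixes h G :: "real \<Rightarrow> real"
  assumes eq: "\<And>t. sin t \<noteq> 0 \<Longrightarrow> h t = G t" and cont: "isCont G \<theta>"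
  shows "cont_ext h \<theta> = G \<theta>"
proof (cases "sin \<theta> = 0")
  case True
  \<comment> \<open>Zeros of sine are spaced by pi, so this punctured interval around a zero
    contains no other one and \<open>h\<close> agrees with \<open>G\<close> on all of it.\<close>
  have "eventually (\<lambda>t. t \<in> {\<theta> - pi<..<\<theta> + pi} - {\<theta>}) (at \<theta>)"
    by (rule eventually_at_in_open) auto
  then have "eventually (\<lambda>t. h t = G t) (at \<theta>)"
  proof eventually_elim
    case (elim t)
    have "sin (t - \<theta>) \<noteq> 0"
    proof (cases "t < \<theta>")
      case True
      then show ?thesis using elim sin_gt_zero[of "\<theta> - t"] by (simp add: sin_diff mult.commute)
    next
      case False
      then show ?thesis using elim sin_gt_zero[of "t - \<theta>"] by simp
    qed
    then have "sin t \<noteq> 0" using True by (simp add: sin_diff)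
    then show ?case by (rule eq)
  qed
  then have "(h \<longlongrightarrow> G \<theta>) (at \<theta>)"
    using cont unfolding isCont_def by (simp add: tendsto_cong)
  then have "Lim (at \<theta>) h = G \<theta>" by (intro tendsto_Lim) auto
  then show ?thesis using True by (simp add: cont_ext_def)
qed (simp add: cont_ext_def eq)

text \<open>Turns comparisons of a spin with \<open>n1\<close> or \<open>n2\<close> into polynomial
  inequalities; \<open>c\<close> stands for the factors \<open>1 - \<epsilon> / R\<close> and
  \<open>1 + \<epsilon> / R\<close>.\<close>

lemma sqrt_divide_mult_less_abs_iff:
  fixes a b c n :: real
  assumes "a > 0" "b > 0" "c > 0"
  shows "sqrt (a / b) * c < \<bar>n\<bar> \<longleftrightarrow> a * c\<^sup>2 < b * n\<^sup>2"
    and "\<bar>n\<bar> < sqrt (a / b) * c \<longleftrightarrow> b * n\<^sup>2 < a * c\<^sup>2"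
proof -
  have s: "sqrt (a / b) * c = sqrt (a * c\<^sup>2 / b)"
    using assms by (simp add: real_sqrt_mult real_sqrt_divide)
  have n: "\<bar>n\<bar> = sqrt (n\<^sup>2)" by simp
  show "sqrt (a / b) * c < \<bar>n\<bar> \<longleftrightarrow> a * c\<^sup>2 < b * n\<^sup>2"
    "\<bar>n\<bar> < sqrt (a / b) * c \<longleftrightarrow> b * n\<^sup>2 < a * c\<^sup>2"
    unfolding s n real_sqrt_less_iff using \<open>b > 0\<close> by (simp_all add: field_simps)
qed

section \<open>The potential and the gyroscopic term as functions of x = cos \<theta>\<close>

locale tippe_top =
  fixes m g A C R \<epsilon> \<mu> :: real
  assumes m: "m > 0" and g: "g > 0" and A: "A > 0" and C: "C > 0" and R: "R > 0" and \<mu>: "\<mu> > 0"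
    and \<epsilon>: "0 < \<epsilon>" and \<epsilon>_less: "\<epsilon> < R"
begin

definition K :: real where "K = m * g * C * R\<^sup>2 * \<epsilon>"

definition P :: "real \<Rightarrow> real" where "P x = (A / C - 1) * x + \<epsilon> / R"

definition Q :: "real \<Rightarrow> real" where "Q x = A / C * (1 - x\<^sup>2) + (x - \<epsilon> / R)\<^sup>2"

definition f_x :: "real \<Rightarrow> real \<Rightarrow> real" where "f_x J x = J\<^sup>2 / K * (A / C - 1) + 4 * P x * Q x"

definition W_x :: "real \<Rightarrow> real \<Rightarrow> real" where
  "W_x J x = m * g * \<epsilon> * f_int m g A C R \<epsilon> (J\<^sup>2) x / (Q x)\<^sup>2"

definition W_xx :: "real \<Rightarrow> real \<Rightarrow> real" where
  "W_xx J x = m * g * \<epsilon> * (f_x J x * (Q x)\<^sup>2 + 4 * f_int m g A C R \<epsilon> (J\<^sup>2) x * Q x * P x) / (Q x) ^ 4"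

text \<open>The chain rule applied twice to a potential that depends on \<theta> through its cosine.
  At a vertical state only the second summand survives, at an intermediate state only the
  first.\<close>

definition W2 :: "real \<Rightarrow> real \<Rightarrow> real" where
  "W2 J \<theta> = (sin \<theta>)\<^sup>2 * W_xx J (cos \<theta>) - cos \<theta> * W_x J (cos \<theta>)"

definition N :: "real \<Rightarrow> real" where
  "N x = R * \<epsilon> * A * (1 - x\<^sup>2) + C * (R + \<epsilon> * x) * (R * x - \<epsilon>)"

definition N_x :: "real \<Rightarrow> real" where
  "N_x x = - 2 * R * \<epsilon> * A * x + C * \<epsilon> * (R * x - \<epsilon>) + C * (R + \<epsilon> * x) * R"

definition tau_x :: "real \<Rightarrow> real \<Rightarrow> real" where
  "tau_x J x = J / (R\<^sup>2 + \<epsilon>\<^sup>2) * ((N_x x * Q x + 2 * N x * P x) / (R\<^sup>2 * C * (Q x)\<^sup>2))"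

lemma K_pos: "K > 0" using m g C R \<epsilon> by (simp add: K_def)

lemma e_pos: "\<epsilon> / R > 0" and e_less: "\<epsilon> / R < 1" using \<epsilon> R \<epsilon>_less by simp_all

lemma f_eq: "f_int m g A C R \<epsilon> (J\<^sup>2) x = J\<^sup>2 / K * P x - (Q x)\<^sup>2"
  by (simp add: f_int_def K_def P_def Q_def)

text \<open>Both summands of \<open>Q\<close> are nonnegative. The first is positive inside the
  interval; at its ends the second is, because the ratio \<open>\<epsilon> / R\<close> lies strictly
  between 0 and 1.\<close>

lemma Q_pos:
  assumes "\<bar>x\<bar> \<le> 1"
  shows "Q x > 0"
proof (cases "\<bar>x\<bar> = 1")
  case True
  then have "x - \<epsilon> / R \<noteq> 0" using e_pos e_less by auto
  moreover have "x\<^sup>2 = 1" using True by (simp add: abs_square_eq_1)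
  ultimately show ?thesis by (simp add: Q_def)
next
  case False
  then have "x\<^sup>2 < 1" using assms by (simp add: abs_square_less_1)
  then show ?thesis using A C unfolding Q_def by (intro add_pos_nonneg mult_pos_pos) auto
qed

lemma Q_cos_pos: "Q (cos \<theta>) > 0" by (simp add: Q_pos)

lemma D_eq: "D_fun A C R \<epsilon> \<theta> = R\<^sup>2 * C * Q (cos \<theta>)"
  unfolding D_fun_def Q_def sin_squared_eq using R C by (simp add: field_simps power2_eq_square)

lemma T_theta_pos: "T_theta m A \<epsilon> \<theta> > 0"
  unfolding T_theta_def using m A by (intro add_nonneg_pos) auto

lemma Q_deriv: "(Q has_real_derivative - 2 * P x) (at x)"
proof -
  have "(Q has_real_derivative A / C * - (2 * x) + 2 * (x - \<epsilon> / R)) (at x)"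
    unfolding Q_def[abs_def] using C by (auto intro!: derivative_eq_intros)
  also have "A / C * - (2 * x) + 2 * (x - \<epsilon> / R) = - 2 * P x"
    by (simp only: P_def) algebra
  finally show ?thesis .
qed

lemma P_deriv: "(P has_real_derivative A / C - 1) (at x)"
  unfolding P_def[abs_def] by (auto intro!: derivative_eq_intros)

lemma f_deriv: "(f_int m g A C R \<epsilon> (J\<^sup>2) has_real_derivative f_x J x) (at x)"
proof -
  have "((\<lambda>x. J\<^sup>2 / K * P x - (Q x)\<^sup>2) has_real_derivative f_x J x) (at x)"
    using K_pos by (auto intro!: derivative_eq_intros Q_deriv P_deriv simp: f_x_def)
  then show ?thesis by (simp add: f_eq[abs_def])
qed

text \<open>An identity of functions rather than of values, so that it can be rewritten under the
  outer derivative in \<open>W_deriv2\<close>.\<close>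

lemma W_deriv: "deriv (W_pot m g A C R \<epsilon> J) = (\<lambda>\<theta>. - sin \<theta> * W_x J (cos \<theta>))"
proof
  fix \<theta> :: real
  let ?x = "cos \<theta>"
  have "((\<lambda>x. J\<^sup>2 / (2 * (R\<^sup>2 * C * Q x)) - m * g * \<epsilon> * x) has_real_derivative W_x J ?x) (at ?x)"
  proof (rule DERIV_cong)
    show "((\<lambda>x. J\<^sup>2 / (2 * (R\<^sup>2 * C * Q x)) - m * g * \<epsilon> * x) has_real_derivative
        (0 * (2 * (R\<^sup>2 * C * Q ?x)) - J\<^sup>2 * (2 * (R\<^sup>2 * C * (- 2 * P ?x))))
          / ((2 * (R\<^sup>2 * C * Q ?x)) * (2 * (R\<^sup>2 * C * Q ?x))) - m * g * \<epsilon>) (at ?x)"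
      using R C Q_cos_pos[of \<theta>]
      by (intro DERIV_diff DERIV_divide DERIV_cmult DERIV_const Q_deriv DERIV_cmult_Id) simp
    have "(0 * (2 * (R\<^sup>2 * C * q)) - J\<^sup>2 * (2 * (R\<^sup>2 * C * (- 2 * p))))
          / ((2 * (R\<^sup>2 * C * q)) * (2 * (R\<^sup>2 * C * q))) - m * g * \<epsilon>
        = m * g * \<epsilon> * (J\<^sup>2 / (m * g * C * R\<^sup>2 * \<epsilon>) * p - q\<^sup>2) / q\<^sup>2" if "q > 0" for p q
      using that R C m g \<epsilon> by (simp add: divide_simps) algebra
    then show "(0 * (2 * (R\<^sup>2 * C * Q ?x)) - J\<^sup>2 * (2 * (R\<^sup>2 * C * (- 2 * P ?x))))
          / ((2 * (R\<^sup>2 * C * Q ?x)) * (2 * (R\<^sup>2 * C * Q ?x))) - m * g * \<epsilon> = W_x J ?x"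
      unfolding W_x_def f_eq K_def using Q_cos_pos[of \<theta>] .
  qed
  from DERIV_chain2[OF this DERIV_cos]
  have "(W_pot m g A C R \<epsilon> J has_real_derivative W_x J ?x * - sin \<theta>) (at \<theta>)"
    by (simp add: W_pot_def[abs_def] D_eq)
  then show "deriv (W_pot m g A C R \<epsilon> J) \<theta> = - sin \<theta> * W_x J ?x"
    by (simp add: DERIV_imp_deriv)
qed

lemma W_deriv2: "deriv (deriv (W_pot m g A C R \<epsilon> J)) \<theta> = W2 J \<theta>"
proof -
  let ?x = "cos \<theta>"
  have "(W_x J has_real_derivative W_xx J ?x) (at ?x)"
  proof (rule DERIV_cong)
    show "(W_x J has_real_derivative
        (m * g * \<epsilon> * f_x J ?x * (Q ?x)\<^sup>2 - m * g * \<epsilon> * f_int m g A C R \<epsilon> (J\<^sup>2) ?x * (2 * Q ?x * (- 2 * P ?x)))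
          / ((Q ?x)\<^sup>2 * (Q ?x)\<^sup>2)) (at ?x)"
      unfolding W_x_def[abs_def] using Q_cos_pos[of \<theta>]
      by (intro DERIV_divide DERIV_cmult f_deriv) (auto intro!: derivative_eq_intros Q_deriv)
  qed (simp add: W_xx_def power4_eq_xxxx power2_eq_square algebra_simps)
  from DERIV_chain2[OF this DERIV_cos]
  have "((\<lambda>t. - sin t * W_x J (cos t)) has_real_derivative W2 J \<theta>) (at \<theta>)"
    by (auto intro!: derivative_eq_intros simp: W2_def power2_eq_square)
  then show ?thesis by (simp add: W_deriv DERIV_imp_deriv)
qed

text \<open>The sine is split off because its square cancels the one in \<open>T_phi\<close>, which
  makes the gyroscopic term of the cubic extend continuously to the vertical states.\<close>

lemma tau_deriv: "deriv (tau A C R \<epsilon> J) \<theta> = - sin \<theta> * tau_x J (cos \<theta>)"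
proof -
  let ?x = "cos \<theta>"
  have N: "(N has_real_derivative N_x x) (at x)" for x
    unfolding N_def[abs_def] N_x_def by (auto intro!: derivative_eq_intros)
  have "R\<^sup>2 * C * Q ?x \<noteq> 0" using R C Q_cos_pos[of \<theta>] by simp
  then have "((\<lambda>x. N x / (R\<^sup>2 * C * Q x)) has_real_derivative
      (N_x ?x * (R\<^sup>2 * C * Q ?x) - N ?x * (R\<^sup>2 * C * (- 2 * P ?x)))
        / ((R\<^sup>2 * C * Q ?x) * (R\<^sup>2 * C * Q ?x))) (at ?x)"
    by (intro DERIV_divide N DERIV_cmult Q_deriv)
  also have "(N_x ?x * (R\<^sup>2 * C * Q ?x) - N ?x * (R\<^sup>2 * C * (- 2 * P ?x)))
        / ((R\<^sup>2 * C * Q ?x) * (R\<^sup>2 * C * Q ?x))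
      = (N_x ?x * Q ?x + 2 * N ?x * P ?x) / (R\<^sup>2 * C * (Q ?x)\<^sup>2)"
    using R C Q_cos_pos[of \<theta>] by (simp add: field_simps power2_eq_square)
  finally have "((\<lambda>x. J / (R\<^sup>2 + \<epsilon>\<^sup>2) * (N x / (R\<^sup>2 * C * Q x))) has_real_derivative tau_x J ?x) (at ?x)"
    unfolding tau_x_def by (rule DERIV_cmult)
  from DERIV_chain2[OF this DERIV_cos]
  have "(tau A C R \<epsilon> J has_real_derivative tau_x J ?x * - sin \<theta>) (at \<theta>)"
    by (simp add: tau_def[abs_def] D_eq N_def sin_squared_eq)
  then show ?thesis by (simp add: DERIV_imp_deriv)
qed

section \<open>Extended coefficients of the cubic and the Routh-Hurwitz criterion\<close>

lemma isCont_PQ [continuous_intros]: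
  "isCont (\<lambda>t. P (cos t)) \<theta>" "isCont (\<lambda>t. Q (cos t)) \<theta>"
  unfolding P_def Q_def by (intro continuous_intros)+

lemma isCont_W2: "isCont (W2 J) \<theta>"
  using Q_cos_pos[of \<theta>]
  unfolding W2_def[abs_def] W_xx_def W_x_def f_eq f_x_def by (intro continuous_intros) auto

lemma isCont_tau_x: "isCont (\<lambda>t. tau_x J (cos t)) \<theta>"
  using Q_cos_pos[of \<theta>] R C
  unfolding tau_x_def N_def N_x_def by (intro continuous_intros) auto

lemma isCont_T_theta: "isCont (T_theta m A \<epsilon>) \<theta>"
  unfolding T_theta_def[abs_def] by (intro continuous_intros)

text \<open>Exposes the only vanishing factor of \<open>T_phi\<close>. Every division by
  \<open>T_phi\<close> in the three coefficients has the same squared sine in its numerator, so all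
  singularities are removable.\<close>

lemma T_phi_eq: "T_phi A C R \<epsilon> \<theta> = A * (sin \<theta>)\<^sup>2 / (R\<^sup>2 * Q (cos \<theta>))"
  using R C Q_cos_pos[of \<theta>] by (simp add: T_phi_def D_eq)

lemma cont_ext_a2:
  "cont_ext (cubic_a2 m g A C R \<epsilon> \<mu>) \<theta> =
    \<mu> * m * g * ((R - \<epsilon> * cos \<theta>)\<^sup>2 / T_theta m A \<epsilon> \<theta> + R\<^sup>2 * Q (cos \<theta>) / A)"
proof (rule cont_ext_eqI)
  fix t :: real assume "sin t \<noteq> 0"
  then show "cubic_a2 m g A C R \<epsilon> \<mu> t =
      \<mu> * m * g * ((R - \<epsilon> * cos t)\<^sup>2 / T_theta m A \<epsilon> t + R\<^sup>2 * Q (cos t) / A)"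
    using A unfolding cubic_a2_def T_phi_eq by simp
next
  show "isCont (\<lambda>t. \<mu> * m * g * ((R - \<epsilon> * cos t)\<^sup>2 / T_theta m A \<epsilon> t + R\<^sup>2 * Q (cos t) / A)) \<theta>"
    using A T_theta_pos[of \<theta>] by (intro continuous_intros isCont_T_theta) auto
qed

lemma cont_ext_a1:
  "cont_ext (cubic_a1 m g A C R \<epsilon> \<mu> J) \<theta> =
    ((\<mu> * m * g * (R - \<epsilon> * cos \<theta>))\<^sup>2 + (tau_x J (cos \<theta>))\<^sup>2) * (R\<^sup>2 * Q (cos \<theta>)) / (A * T_theta m A \<epsilon> \<theta>)
    + W2 J \<theta> / T_theta m A \<epsilon> \<theta>"
proof (rule cont_ext_eqI)
  fix t :: real assume s: "sin t \<noteq> 0"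
  have "(\<mu> * m * g * (R - \<epsilon> * cos t) * sin t)\<^sup>2 + (- sin t * tau_x J (cos t))\<^sup>2
      = ((\<mu> * m * g * (R - \<epsilon> * cos t))\<^sup>2 + (tau_x J (cos t))\<^sup>2) * (sin t)\<^sup>2"
    by (simp add: power_mult_distrib distrib_right)
  then show "cubic_a1 m g A C R \<epsilon> \<mu> J t =
      ((\<mu> * m * g * (R - \<epsilon> * cos t))\<^sup>2 + (tau_x J (cos t))\<^sup>2) * (R\<^sup>2 * Q (cos t)) / (A * T_theta m A \<epsilon> t)
      + W2 J t / T_theta m A \<epsilon> t"
    unfolding cubic_a1_def W_deriv2 tau_deriv T_phi_eq
    using A s T_theta_pos[of t] by (simp add: mult_ac)
next
  show "isCont (\<lambda>t. ((\<mu> * m * g * (R - \<epsilon> * cos t))\<^sup>2 + (tau_x J (cos t))\<^sup>2) * (R\<^sup>2 * Q (cos t))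
        / (A * T_theta m A \<epsilon> t) + W2 J t / T_theta m A \<epsilon> t) \<theta>"
    using A T_theta_pos[of \<theta>]
    by (intro continuous_intros isCont_T_theta isCont_tau_x isCont_W2) auto
qed

lemma cont_ext_a0:
  "cont_ext (cubic_a0 m g A C R \<epsilon> \<mu> J) \<theta> =
    \<mu> * m * g * (R\<^sup>2 * Q (cos \<theta>)) * W2 J \<theta> / (A * T_theta m A \<epsilon> \<theta>)"
proof (rule cont_ext_eqI)
  fix t :: real assume s: "sin t \<noteq> 0"
  then show "cubic_a0 m g A C R \<epsilon> \<mu> J t =
      \<mu> * m * g * (R\<^sup>2 * Q (cos t)) * W2 J t / (A * T_theta m A \<epsilon> t)"
    unfolding cubic_a0_def W_deriv2 T_phi_eq
    using A T_theta_pos[of t] by (simp add: mult_ac)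
next
  show "isCont (\<lambda>t. \<mu> * m * g * (R\<^sup>2 * Q (cos t)) * W2 J t / (A * T_theta m A \<epsilon> t)) \<theta>"
    using A T_theta_pos[of \<theta>] by (intro continuous_intros isCont_T_theta isCont_W2) auto
qed

text \<open>The quadratic coefficient is always positive and the constant one has the sign of
  \<open>W2\<close>. If \<open>W2\<close> is positive, the remaining Hurwitz inequality is
  automatic; if not, there is a nonnegative real root. The equivalence holds at every angle, not
  only at equilibria.\<close>

lemma char_cubic_roots_neg_iff:
  "(\<forall>z. char_cubic m g A C R \<epsilon> \<mu> J \<theta> z = 0 \<longrightarrow> Re z < 0) \<longleftrightarrow> W2 J \<theta> > 0"
proof -
  define c T r d w where "c = \<mu> * m * g" and "T = T_theta m A \<epsilon> \<theta>"
    and "r = R - \<epsilon> * cos \<theta>" and "d = R\<^sup>2 * Q (cos \<theta>) / A" and "w = W2 J \<theta>"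
  have c: "c > 0" using m g \<mu> by (simp add: c_def)
  have T: "T > 0" by (simp add: T_def T_theta_pos)
  have d: "d > 0" using R A Q_cos_pos[of \<theta>] by (simp add: d_def)
  define t2 where "t2 = (tau_x J (cos \<theta>))\<^sup>2"
  define a2 a1 a0 where "a2 = c * (r\<^sup>2 / T + d)" and "a1 = ((c * r)\<^sup>2 + t2) * d / T + w / T"
    and "a0 = c * d * w / T"
  have a2: "cont_ext (cubic_a2 m g A C R \<epsilon> \<mu>) \<theta> = a2"
    unfolding cont_ext_a2 a2_def c_def T_def r_def d_def by simp
  have a1: "cont_ext (cubic_a1 m g A C R \<epsilon> \<mu> J) \<theta> = a1"
    unfolding cont_ext_a1 a1_def c_def T_def r_def d_def t2_def w_def by simp
  have a0: "cont_ext (cubic_a0 m g A C R \<epsilon> \<mu> J) \<theta> = a0"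
    unfolding cont_ext_a0 a0_def c_def T_def d_def w_def by simp
  note cubic = char_cubic_def a2 a1 a0
  show ?thesis
  proof
    assume roots: "\<forall>z. char_cubic m g A C R \<epsilon> \<mu> J \<theta> z = 0 \<longrightarrow> Re z < 0"
    show "W2 J \<theta> > 0"
    proof (rule ccontr)
      assume "\<not> W2 J \<theta> > 0"
      then have "a0 \<le> 0" using c d T by (simp add: a0_def w_def divide_nonpos_pos mult_nonneg_nonpos)
      from cubic_nonneg_root[OF this] obtain t
        where t: "t \<ge> 0" "t ^ 3 + a2 * t\<^sup>2 + a1 * t + a0 = 0" by blast
      then have "complex_of_real (t ^ 3 + a2 * t\<^sup>2 + a1 * t + a0) = 0" by simp
      then have "char_cubic m g A C R \<epsilon> \<mu> J \<theta> (of_real t) = 0" unfolding cubic by simp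
      with roots have "t < 0" by fastforce
      with t show False by simp
    qed
  next
    assume "W2 J \<theta> > 0"
    then have w: "w > 0" by (simp add: w_def)
    have "\<bar>\<epsilon> * cos \<theta>\<bar> \<le> \<epsilon> * 1" using \<epsilon> by (simp add: abs_mult mult_left_le)
    then have r: "r > 0" using \<epsilon>_less by (simp add: r_def)
    have "a2 > 0" unfolding a2_def using c d T by (intro mult_pos_pos add_nonneg_pos) auto
    moreover have "a0 > 0" unfolding a0_def using c d T w by simp
    moreover have "a2 * a1 > a0"
    proof -
      \<comment> \<open>Each of these two factors is a summand of \<open>a2\<close> or
        \<open>a1\<close> respectively. The other summand is strictly positive in both cases, thanks
        to friction and \<open>r > 0\<close>; the gyroscopic square \<open>t2\<close> only adds to
        \<open>a1\<close>.\<close>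
      have "a0 = (c * d) * (w / T)" by (simp add: a0_def)
      also have "\<dots> < a2 * a1"
      proof (rule mult_strict_mono)
        show "c * d < a2" using c r T by (simp add: a2_def)
        have "0 < ((c * r)\<^sup>2 + t2) * d / T" using c r d T by (simp add: t2_def add_pos_nonneg)
        then show "w / T < a1" by (simp add: a1_def)
      qed (use c d T w \<open>a2 > 0\<close> in auto)
      finally show ?thesis .
    qed
    ultimately show "\<forall>z. char_cubic m g A C R \<epsilon> \<mu> J \<theta> z = 0 \<longrightarrow> Re z < 0"
      unfolding cubic using cubic_roots_Re_neg by blast
  qed
qed

section \<open>Stability of the vertical states\<close>

abbreviation equilibrium where "equilibrium \<equiv> relative_equilibrium m g A C R \<epsilon>"
abbreviation stable where "stable \<equiv> stable_state m g A C R \<epsilon> \<mu>"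
abbreviation unstable where "unstable \<equiv> unstable_state m g A C R \<epsilon> \<mu>"
abbreviation intermediate where "intermediate \<equiv> intermediate_state m g A C R \<epsilon>"
abbreviation bifurcation where "bifurcation \<equiv> bifurcation_point m g A C R \<epsilon>"

lemma stable_iff: "equilibrium J \<theta> \<Longrightarrow> stable J \<theta> \<longleftrightarrow> W2 J \<theta> > 0"
  by (simp add: stable_state_def char_cubic_roots_neg_iff)

lemma unstable_iff: "equilibrium J \<theta> \<Longrightarrow> unstable J \<theta> \<longleftrightarrow> \<not> stable J \<theta>"
  by (simp add: unstable_state_def)

lemma equilibrium_0: "equilibrium J 0" and equilibrium_pi: "equilibrium J pi"
  by (simp_all add: relative_equilibrium_def W_deriv)

lemma equilibrium_intermediate:
  assumes "intermediate J \<theta>"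
  shows "equilibrium J \<theta>"
proof -
  have "0 \<le> \<theta>" "\<theta> \<le> pi" using assms by (auto simp: intermediate_state_def)
  from relative_equilibrium_iff[OF m g A C \<epsilon> \<epsilon>_less this] assms show ?thesis by simp
qed

lemma unstable_0_iff: "unstable J 0 \<longleftrightarrow> \<not> stable J 0"
  and unstable_pi_iff: "unstable J pi \<longleftrightarrow> \<not> stable J pi"
  by (simp_all add: unstable_iff equilibrium_0 equilibrium_pi)

lemma unstable_intermediate_iff: "intermediate J \<theta> \<Longrightarrow> unstable J \<theta> \<longleftrightarrow> \<not> stable J \<theta>"
  by (simp add: unstable_iff equilibrium_intermediate)

text \<open>Here \<open>W2\<close> is \<open>- W_x J 1\<close>, so stability means f < 0 at x = 1.
  Replacing \<open>J\<close> by the spin gives an inequality free of square roots, which covers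
  Group I, where \<open>A / C - (1 - \<epsilon> / R)\<close> is negative, together with the other
  groups.\<close>

lemma stable_0_iff:
  "stable J 0 \<longleftrightarrow> C * (A / C - (1 - \<epsilon> / R)) * (spin_0 C R \<epsilon> J)\<^sup>2 < m * g * \<epsilon> * (1 - \<epsilon> / R)\<^sup>2"
proof -
  define e where "e = \<epsilon> / R"
  have e: "0 < e" "e < 1" using e_pos e_less by (simp_all add: e_def)
  have \<epsilon>_eq: "\<epsilon> = e * R" using R by (simp add: e_def)
  define n where "n = spin_0 C R \<epsilon> J"
  have "R - \<epsilon> = R * (1 - e)" by (simp add: \<epsilon>_eq algebra_simps)
  then have J: "J = n * (C * (R * (1 - e)))" using C R e by (simp add: n_def spin_0_def)
  have PQ: "P 1 = A / C - (1 - e)" "Q 1 = (1 - e)\<^sup>2" by (simp_all add: P_def Q_def e_def)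
  have "J\<^sup>2 / K = (1 - e)\<^sup>2 * (C * n\<^sup>2) / (m * g * \<epsilon>)"
    unfolding J K_def using C R m g \<epsilon> by (simp add: field_simps power2_eq_square)
  then have "f_int m g A C R \<epsilon> (J\<^sup>2) 1 =
      (1 - e)\<^sup>2 * (C * n\<^sup>2) / (m * g * \<epsilon>) * (A / C - (1 - e)) - ((1 - e)\<^sup>2)\<^sup>2"
    by (simp only: f_eq PQ)
  \<comment> \<open>Pulls a positive factor out of f, so that its sign is that of the bracket
    comparing the spin with its threshold.\<close>
  moreover have idn: "q * (c * n) / M * k - q\<^sup>2 = q / M * (c * k * n - M * q)" if "M > 0" for q c n k M :: real
    using that by (simp add: field_simps power2_eq_square)
  moreover have "m * g * \<epsilon> > 0" using m g \<epsilon> by simp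
  ultimately have "f_int m g A C R \<epsilon> (J\<^sup>2) 1 =
      (1 - e)\<^sup>2 / (m * g * \<epsilon>) * (C * (A / C - (1 - e)) * n\<^sup>2 - m * g * \<epsilon> * (1 - e)\<^sup>2)"
    by (simp only: idn)
  then have "W2 J 0 = -(m * g * \<epsilon> * ((1 - e)\<^sup>2 / (m * g * \<epsilon>) * (C * (A / C - (1 - e)) * n\<^sup>2 - m * g * \<epsilon> * (1 - e)\<^sup>2)) / (Q 1)\<^sup>2)"
    by (simp only: W2_def W_x_def) simp
  also have "\<dots> = (1 - e)\<^sup>2 / (Q 1)\<^sup>2 * - (C * (A / C - (1 - e)) * n\<^sup>2 - m * g * \<epsilon> * (1 - e)\<^sup>2)"
  proof -
    have "- (M * (q / M * b) / r) = q / r * - b" if "M > 0" for M q b r :: real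
      using that by simp
    then show ?thesis using m g \<epsilon> by (meson mult_pos_pos)
  qed
  finally have "W2 J 0 = (1 - e)\<^sup>2 / (Q 1)\<^sup>2 * - (C * (A / C - (1 - e)) * n\<^sup>2 - m * g * \<epsilon> * (1 - e)\<^sup>2)" .
  moreover have "(1 - e)\<^sup>2 / (Q 1)\<^sup>2 > 0" using e PQ by simp
  ultimately have "W2 J 0 > 0 \<longleftrightarrow> C * (A / C - (1 - e)) * n\<^sup>2 - m * g * \<epsilon> * (1 - e)\<^sup>2 < 0" by (simp only: zero_less_mult_iff) auto
  then show ?thesis unfolding stable_iff[OF equilibrium_0] n_def e_def by linarith
qed

text \<open>The same computation at x = -1. The cosine changes sign, so \<open>W2\<close> is
  \<open>+ W_x J (- 1)\<close> and stability now requires f > 0.\<close>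

lemma stable_pi_iff:
  "stable J pi \<longleftrightarrow> m * g * \<epsilon> * (1 + \<epsilon> / R)\<^sup>2 < C * ((1 + \<epsilon> / R) - A / C) * (spin_pi C R \<epsilon> J)\<^sup>2"
proof -
  define e where "e = \<epsilon> / R"
  have e: "0 < e" using e_pos by (simp add: e_def)
  have \<epsilon>_eq: "\<epsilon> = e * R" using R by (simp add: e_def)
  define n where "n = spin_pi C R \<epsilon> J"
  have "R + \<epsilon> = R * (1 + e)" by (simp add: \<epsilon>_eq algebra_simps)
  then have J: "J = - n * (C * (R * (1 + e)))" using C R e by (simp add: n_def spin_pi_def)
  have PQ: "P (- 1) = (1 + e) - A / C" "Q (- 1) = (1 + e)\<^sup>2"
    by (simp_all add: P_def Q_def e_def power2_eq_square algebra_simps)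
  have "J\<^sup>2 / K = (1 + e)\<^sup>2 * (C * n\<^sup>2) / (m * g * \<epsilon>)"
    unfolding J K_def using C R m g \<epsilon> by (simp add: field_simps power2_eq_square)
  then have "f_int m g A C R \<epsilon> (J\<^sup>2) (- 1) =
      (1 + e)\<^sup>2 * (C * n\<^sup>2) / (m * g * \<epsilon>) * ((1 + e) - A / C) - ((1 + e)\<^sup>2)\<^sup>2"
    by (simp only: f_eq PQ)
  moreover have idn: "q * (c * n) / M * k - q\<^sup>2 = q / M * (c * k * n - M * q)" if "M > 0" for q c n k M :: real
    using that by (simp add: field_simps power2_eq_square)
  moreover have "m * g * \<epsilon> > 0" using m g \<epsilon> by simp
  ultimately have "f_int m g A C R \<epsilon> (J\<^sup>2) (- 1) =
      (1 + e)\<^sup>2 / (m * g * \<epsilon>) * (C * ((1 + e) - A / C) * n\<^sup>2 - m * g * \<epsilon> * (1 + e)\<^sup>2)"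
    by (simp only: idn)
  then have "W2 J pi = (m * g * \<epsilon> * ((1 + e)\<^sup>2 / (m * g * \<epsilon>) * (C * ((1 + e) - A / C) * n\<^sup>2 - m * g * \<epsilon> * (1 + e)\<^sup>2)) / (Q (- 1))\<^sup>2)"
    by (simp only: W2_def W_x_def) simp
  also have "\<dots> = (1 + e)\<^sup>2 / (Q (- 1))\<^sup>2 * (C * ((1 + e) - A / C) * n\<^sup>2 - m * g * \<epsilon> * (1 + e)\<^sup>2)"
    using m g \<epsilon> by simp
  finally have "W2 J pi = (1 + e)\<^sup>2 / (Q (- 1))\<^sup>2 * (C * ((1 + e) - A / C) * n\<^sup>2 - m * g * \<epsilon> * (1 + e)\<^sup>2)" .
  moreover have "(1 + e)\<^sup>2 / (Q (- 1))\<^sup>2 > 0" using e PQ by simp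
  ultimately have "W2 J pi > 0 \<longleftrightarrow> C * ((1 + e) - A / C) * n\<^sup>2 - m * g * \<epsilon> * (1 + e)\<^sup>2 > 0" by (simp only: zero_less_mult_iff) auto
  then show ?thesis unfolding stable_iff[OF equilibrium_pi] n_def e_def by linarith
qed

lemma stable_0_spin:
  assumes "A / C - 1 > - (\<epsilon> / R)"
  defines "n1 \<equiv> sqrt (m * g * \<epsilon> / (C * (A / C - (1 - \<epsilon> / R)))) * (1 - \<epsilon> / R)"
  shows "\<bar>spin_0 C R \<epsilon> J\<bar> < n1 \<Longrightarrow> stable J 0" and "\<bar>spin_0 C R \<epsilon> J\<bar> > n1 \<Longrightarrow> unstable J 0"
proof -
  have "m * g * \<epsilon> > 0" using m g \<epsilon> by simp
  moreover have "C * (A / C - (1 - \<epsilon> / R)) > 0" using C assms(1) by simp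
  moreover have "1 - \<epsilon> / R > 0" using e_less by simp
  ultimately have lt: "n1 < \<bar>n\<bar> \<longleftrightarrow> m * g * \<epsilon> * (1 - \<epsilon> / R)\<^sup>2 < C * (A / C - (1 - \<epsilon> / R)) * n\<^sup>2"
    and gt: "\<bar>n\<bar> < n1 \<longleftrightarrow> C * (A / C - (1 - \<epsilon> / R)) * n\<^sup>2 < m * g * \<epsilon> * (1 - \<epsilon> / R)\<^sup>2" for n
    unfolding n1_def by (rule sqrt_divide_mult_less_abs_iff)+
  show "\<bar>spin_0 C R \<epsilon> J\<bar> < n1 \<Longrightarrow> stable J 0" unfolding gt stable_0_iff .
  show "\<bar>spin_0 C R \<epsilon> J\<bar> > n1 \<Longrightarrow> unstable J 0" unfolding lt unstable_0_iff stable_0_iff by linarith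
qed

text \<open>At the threshold itself \<open>W2\<close> vanishes and 0 is a root of the cubic, so
  equality belongs to the unstable case and the two claims are exact complements.\<close>

lemma stable_pi_spin:
  assumes "A / C - 1 < \<epsilon> / R"
  defines "n2 \<equiv> sqrt (m * g * \<epsilon> / (C * ((1 + \<epsilon> / R) - A / C))) * (1 + \<epsilon> / R)"
  shows "\<bar>spin_pi C R \<epsilon> J\<bar> > n2 \<Longrightarrow> stable J pi"
    and "\<not> \<bar>spin_pi C R \<epsilon> J\<bar> > n2 \<Longrightarrow> unstable J pi"
proof -
  have "m * g * \<epsilon> > 0" using m g \<epsilon> by simp
  moreover have "C * ((1 + \<epsilon> / R) - A / C) > 0" using C assms(1) by simp
  moreover have "1 + \<epsilon> / R > 0" using e_pos by simp
  ultimately have lt: "n2 < \<bar>n\<bar> \<longleftrightarrow>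
      m * g * \<epsilon> * (1 + \<epsilon> / R)\<^sup>2 < C * ((1 + \<epsilon> / R) - A / C) * n\<^sup>2" for n
    unfolding n2_def by (rule sqrt_divide_mult_less_abs_iff)
  show "\<bar>spin_pi C R \<epsilon> J\<bar> > n2 \<Longrightarrow> stable J pi" unfolding lt stable_pi_iff .
  show "\<not> \<bar>spin_pi C R \<epsilon> J\<bar> > n2 \<Longrightarrow> unstable J pi"
    unfolding lt unstable_pi_iff stable_pi_iff .
qed

section \<open>Existence, stability and bifurcation of intermediate states\<close>

lemma intermediate_P_pos:
  assumes "intermediate J \<theta>"
  shows "P (cos \<theta>) > 0"
proof -
  have "J\<^sup>2 / K * P (cos \<theta>) = (Q (cos \<theta>))\<^sup>2" using assms by (simp add: intermediate_state_def f_eq)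
  also have "\<dots> > 0" using Q_cos_pos[of \<theta>] by simp
  finally have "J\<^sup>2 / K * P (cos \<theta>) > 0" .
  moreover have "J\<^sup>2 / K \<ge> 0" using K_pos by simp
  ultimately show ?thesis by (simp only: zero_less_mult_iff) linarith
qed

lemma ex_intermediate_iff:
  "(\<exists>J. intermediate J \<theta>) \<longleftrightarrow> 0 < \<theta> \<and> \<theta> < pi \<and> P (cos \<theta>) > 0"
proof
  assume th: "0 < \<theta> \<and> \<theta> < pi \<and> P (cos \<theta>) > 0"
  \<comment> \<open>The solution of f = 0 for the Jellet value, that is, of
    \<open>J\<^sup>2 / K * P = Q\<^sup>2\<close>; the square root is legitimate because
    \<open>P > 0\<close>.\<close>
  define J where "J = Q (cos \<theta>) * sqrt (K / P (cos \<theta>))"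
  have "J\<^sup>2 = (Q (cos \<theta>))\<^sup>2 * (K / P (cos \<theta>))"
    using th K_pos by (simp add: J_def power_mult_distrib)
  then have "J\<^sup>2 / K * P (cos \<theta>) = (Q (cos \<theta>))\<^sup>2" using th K_pos by simp
  then have "intermediate J \<theta>" using th by (simp add: intermediate_state_def f_eq)
  then show "\<exists>J. intermediate J \<theta>" ..
qed (auto simp: intermediate_P_pos intermediate_state_def)

lemma intermediate_f_x:
  assumes "intermediate J \<theta>"
  shows "f_x J (cos \<theta>) =
    Q (cos \<theta>) / P (cos \<theta>) * (3 * (P (cos \<theta>))\<^sup>2 - A / C * (1 - A / C - (\<epsilon> / R)\<^sup>2))"
proof -
  define p q where "p = P (cos \<theta>)" and "q = Q (cos \<theta>)"
  have p: "p > 0" using intermediate_P_pos[OF assms] by (simp add: p_def)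
  have "J\<^sup>2 / K * p = q\<^sup>2" using assms by (simp add: intermediate_state_def f_eq p_def q_def)
  then have j: "J\<^sup>2 / K = q\<^sup>2 / p" using p by (simp add: field_simps)
  have "f_x J (cos \<theta>) = q / p * (4 * p\<^sup>2 - (1 - A / C) * q)"
    unfolding f_x_def p_def[symmetric] q_def[symmetric] j using p
    by (simp add: field_simps power2_eq_square)
  \<comment> \<open>Completing the square in x, with a = A/C and e = \<epsilon>/R, gives (1 - a) Q =
    P^2 + a (1 - a - e^2). The sign of the derivative thus depends on x through \<open>P\<close>
    alone.\<close>
  also have "4 * p\<^sup>2 - (1 - A / C) * q = 3 * p\<^sup>2 - A / C * (1 - A / C - (\<epsilon> / R)\<^sup>2)"
  proof -
    have "4 * ((a - 1) * x + e)\<^sup>2 - (1 - a) * (a * (1 - x\<^sup>2) + (x - e)\<^sup>2)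
        = 3 * ((a - 1) * x + e)\<^sup>2 - a * (1 - a - e\<^sup>2)" for a e x :: real
      by algebra
    then show ?thesis unfolding p_def q_def P_def Q_def .
  qed
  finally show ?thesis by (simp add: p_def q_def)
qed

text \<open>Since f = 0, the first-derivative term of \<open>W2\<close> and the second term of
  \<open>W_xx\<close> vanish, and \<open>W2\<close> is a positive multiple of
  \<open>f_x\<close>.\<close>

lemma stable_intermediate_iff:
  assumes "intermediate J \<theta>"
  shows "stable J \<theta> \<longleftrightarrow> 3 * (P (cos \<theta>))\<^sup>2 > A / C * (1 - A / C - (\<epsilon> / R)\<^sup>2)"
proof -
  have f: "f_int m g A C R \<epsilon> (J\<^sup>2) (cos \<theta>) = 0" and s: "sin \<theta> > 0"
    using assms by (auto simp: intermediate_state_def sin_gt_zero)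
  have "W2 J \<theta> > 0 \<longleftrightarrow> f_x J (cos \<theta>) > 0"
  proof -
    have "W2 J \<theta> = (sin \<theta>)\<^sup>2 * (m * g * \<epsilon>) / (Q (cos \<theta>))\<^sup>2 * f_x J (cos \<theta>)"
      unfolding W2_def W_xx_def W_x_def f using Q_cos_pos[of \<theta>]
      by (simp add: power4_eq_xxxx power2_eq_square)
    moreover have "(sin \<theta>)\<^sup>2 * (m * g * \<epsilon>) / (Q (cos \<theta>))\<^sup>2 > 0"
      using s m g \<epsilon> Q_cos_pos[of \<theta>] by simp
    ultimately show ?thesis by (simp only: zero_less_mult_iff) auto
  qed
  also have "\<dots> \<longleftrightarrow> 3 * (P (cos \<theta>))\<^sup>2 > A / C * (1 - A / C - (\<epsilon> / R)\<^sup>2)"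
  proof -
    have "Q (cos \<theta>) / P (cos \<theta>) > 0" using Q_cos_pos[of \<theta>] intermediate_P_pos[OF assms] by simp
    then show ?thesis unfolding intermediate_f_x[OF assms] by (simp only: zero_less_mult_iff) auto
  qed
  finally show ?thesis by (simp add: stable_iff equilibrium_intermediate assms)
qed

text \<open>The fold condition is the vanishing of the same \<open>f_x\<close> whose sign decides
  stability, so bifurcation is the case of equality in
  \<open>stable_intermediate_iff\<close>.\<close>

lemma bifurcation_iff:
  "bifurcation J \<theta> \<longleftrightarrow>
    intermediate J \<theta> \<and> 3 * (P (cos \<theta>))\<^sup>2 = A / C * (1 - A / C - (\<epsilon> / R)\<^sup>2)"
proof (cases "intermediate J \<theta>")
  case True
  then show ?thesis
    using Q_cos_pos[of \<theta>] intermediate_P_pos[OF True]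
    by (simp add: bifurcation_point_def DERIV_imp_deriv[OF f_deriv] intermediate_f_x)
qed (simp add: bifurcation_point_def)

text \<open>The right-hand side of the stability criterion is at most 0 here, while the left-hand
  side is positive.\<close>

lemma no_fold:
  assumes "A / C - 1 \<ge> - (\<epsilon> / R)\<^sup>2" "intermediate J \<theta>"
  shows "stable J \<theta>" "\<not> bifurcation J \<theta>"
proof -
  have "A / C * (1 - A / C - (\<epsilon> / R)\<^sup>2) \<le> 0" using A C assms(1) by (intro mult_nonneg_nonpos) auto
  moreover have "3 * (P (cos \<theta>))\<^sup>2 > 0" using intermediate_P_pos[OF assms(2)] by simp
  ultimately show "stable J \<theta>" "\<not> bifurcation J \<theta>"
    using assms(2) unfolding bifurcation_iff stable_intermediate_iff[OF assms(2)] by linarith+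
qed

text \<open>\<open>P\<close> is affine with slope -(1 - A/C) < 0, so the minus sign in
  \<open>x_bif\<close> selects the positive solution p of 3 p^2 = (A/C)(1 - A/C -
  (\<epsilon>/R)^2).\<close>

lemma P_x_bif:
  assumes "A / C - 1 < - (\<epsilon> / R)\<^sup>2"
  shows "P (x_bif A C R \<epsilon>) > 0"
    and "3 * (P (x_bif A C R \<epsilon>))\<^sup>2 = A / C * (1 - A / C - (\<epsilon> / R)\<^sup>2)"
proof -
  define k where "k = 1 - A / C"
  have "0 \<le> (\<epsilon> / R)\<^sup>2" by simp
  then have k: "k > 0" "k - (\<epsilon> / R)\<^sup>2 > 0" using assms unfolding k_def by linarith+
  have "P x = \<epsilon> / R - k * x" for x by (simp add: P_def k_def algebra_simps)
  then have P: "P (x_bif A C R \<epsilon>) = sqrt 3 / 3 * sqrt (A / C) * sqrt (k - (\<epsilon> / R)\<^sup>2)"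
    unfolding x_bif_def k_def[symmetric] using k by (simp add: right_diff_distrib)
  show "P (x_bif A C R \<epsilon>) > 0"
    unfolding P using A C k(2) by (intro mult_pos_pos) simp_all
  have "(sqrt (k - (\<epsilon> / R)\<^sup>2))\<^sup>2 = k - (\<epsilon> / R)\<^sup>2" "(sqrt (A / C))\<^sup>2 = A / C" "3 * (sqrt 3 / 3)\<^sup>2 = (1::real)"
    using A C k(2) by (simp_all add: power_divide)
  then show "3 * (P (x_bif A C R \<epsilon>))\<^sup>2 = A / C * (1 - A / C - (\<epsilon> / R)\<^sup>2)"
    unfolding P power_mult_distrib k_def by simp
qed

text \<open>The criterion compares squares of two positive values of \<open>P\<close>, hence the
  values themselves; \<open>P\<close> is decreasing, which reverses the order of the
  arguments.\<close>

lemma stable_intermediate_x_bif: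
  assumes "A / C - 1 < - (\<epsilon> / R)\<^sup>2" "intermediate J \<theta>"
  shows "stable J \<theta> \<longleftrightarrow> cos \<theta> < x_bif A C R \<epsilon>"
proof -
  let ?b = "x_bif A C R \<epsilon>"
  have "0 \<le> (\<epsilon> / R)\<^sup>2" by simp
  then have k: "A / C - 1 < 0" using assms(1) by linarith
  have "stable J \<theta> \<longleftrightarrow> (P ?b)\<^sup>2 < (P (cos \<theta>))\<^sup>2"
    unfolding stable_intermediate_iff[OF assms(2)] P_x_bif(2)[OF assms(1), symmetric] by simp
  also have "\<dots> \<longleftrightarrow> P ?b < P (cos \<theta>)"
    using P_x_bif(1)[OF assms(1)] intermediate_P_pos[OF assms(2)]
    by (meson less_eq_real_def power2_less_imp_less power_strict_mono pos2)
  also have "\<dots> \<longleftrightarrow> cos \<theta> < ?b"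
    using k by (simp add: P_def mult_less_cancel_left_neg)
  finally show ?thesis .
qed

lemma bifurcation_structure:
  assumes k: "A / C - 1 < - (\<epsilon> / R)\<^sup>2" and b: "- 1 < x_bif A C R \<epsilon>" "x_bif A C R \<epsilon> < 1"
  defines "\<theta>\<^sub>b \<equiv> arccos (x_bif A C R \<epsilon>)"
  shows "\<exists>J. bifurcation J \<theta>\<^sub>b"
    and "intermediate J \<theta> \<Longrightarrow> \<theta> > \<theta>\<^sub>b \<Longrightarrow> stable J \<theta>"
    and "intermediate J \<theta> \<Longrightarrow> \<theta> < \<theta>\<^sub>b \<Longrightarrow> unstable J \<theta>"
proof -
  have cb: "cos \<theta>\<^sub>b = x_bif A C R \<epsilon>" using b by (simp add: \<theta>\<^sub>b_def)
  have tb: "0 < \<theta>\<^sub>b" "\<theta>\<^sub>b < pi" using arccos_lt_bounded[OF b] by (simp_all add: \<theta>\<^sub>b_def)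
  have "\<exists>J. intermediate J \<theta>\<^sub>b" unfolding ex_intermediate_iff cb using tb P_x_bif(1)[OF k] by simp
  then show "\<exists>J. bifurcation J \<theta>\<^sub>b" unfolding bifurcation_iff cb using P_x_bif(2)[OF k] by blast
  show "stable J \<theta>" if "intermediate J \<theta>" "\<theta> > \<theta>\<^sub>b"
    using that tb cos_monotone_0_pi[of \<theta>\<^sub>b \<theta>]
    by (simp add: stable_intermediate_x_bif[OF k] cb intermediate_state_def)
  show "unstable J \<theta>" if "intermediate J \<theta>" "\<theta> < \<theta>\<^sub>b"
  proof -
    have "cos \<theta> > x_bif A C R \<epsilon>"
      using that tb cos_monotone_0_pi[of \<theta> \<theta>\<^sub>b] by (simp add: cb intermediate_state_def)
    then show ?thesis
      using that(1) by (simp add: unstable_intermediate_iff stable_intermediate_x_bif[OF k])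
  qed
qed

section \<open>Tipping and the three parameter groups\<close>

lemma tipping_spin:
  assumes k: "A / C - 1 < \<epsilon> / R"
    and n: "\<bar>spin_0 C R \<epsilon> J\<bar> >
      sqrt (m * g * \<epsilon> / (C * ((1 + \<epsilon> / R) - A / C))) * (1 + \<epsilon> / R) * ((R + \<epsilon>) / (R - \<epsilon>))"
  shows "stable J pi"
proof -
  \<comment> \<open>Both spins come from the same Jellet value; their ratio is the factor by which
    \<open>n2\<close> is multiplied in the tipping threshold.\<close>
  have "spin_pi C R \<epsilon> J = - (spin_0 C R \<epsilon> J / ((R + \<epsilon>) / (R - \<epsilon>)))"
    using \<epsilon>_less by (simp add: spin_pi_def spin_0_def)
  then have abs: "\<bar>spin_pi C R \<epsilon> J\<bar> = \<bar>spin_0 C R \<epsilon> J\<bar> / ((R + \<epsilon>) / (R - \<epsilon>))"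
    using R \<epsilon> \<epsilon>_less by (simp add: abs_mult)
  have "(R + \<epsilon>) / (R - \<epsilon>) > 0" using R \<epsilon> \<epsilon>_less by simp
  with n show ?thesis
    by (intro stable_pi_spin(1)[OF k]) (simp only: abs pos_less_divide_eq)
qed

lemma groupI:
  assumes k: "A / C - 1 < - (\<epsilon> / R)"
  shows "stable J 0"
    and "(\<exists>J. intermediate J \<theta>) \<longleftrightarrow> arccos ((\<epsilon> / R) / (1 - A / C)) < \<theta> \<and> \<theta> < pi"
    and "A / C - 1 < - (\<epsilon> / R)\<^sup>2"
    and "x_bif A C R \<epsilon> < 1"
proof -
  have e2: "(\<epsilon> / R)\<^sup>2 < \<epsilon> / R" using power_strict_decreasing[of 1 2 "\<epsilon> / R"] e_pos e_less by simp
  then show k2: "A / C - 1 < - (\<epsilon> / R)\<^sup>2" using k by linarith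
  have "C * (A / C - (1 - \<epsilon> / R)) * (spin_0 C R \<epsilon> J)\<^sup>2 \<le> 0"
    using C k by (intro mult_nonpos_nonneg mult_nonneg_nonpos) auto
  also have "0 < m * g * \<epsilon> * (1 - \<epsilon> / R)\<^sup>2" using m g \<epsilon> e_less by (intro mult_pos_pos) auto
  finally show "stable J 0" unfolding stable_0_iff .
  define y where "y = (\<epsilon> / R) / (1 - A / C)"
  have kpos: "1 - A / C > 0" using k e_pos by linarith
  \<comment> \<open>\<open>y\<close> is the zero of \<open>P\<close> and the cosine of the critical
    angle. In this group it lies inside the range of the cosine, and intermediate states occur
    exactly on the side x < y.\<close>
  have y: "0 < y" "y < 1"
    unfolding y_def pos_divide_less_eq[OF kpos] using k divide_pos_pos[OF e_pos kpos] by simp_all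
  have P: "P x > 0 \<longleftrightarrow> x < y" for x
  proof -
    have "P x = \<epsilon> / R - x * (1 - A / C)" by (simp add: P_def algebra_simps)
    then show ?thesis unfolding y_def pos_less_divide_eq[OF kpos] by linarith
  qed
  \<comment> \<open>Positivity of \<open>P\<close> at \<open>x_bif\<close> places it below
    \<open>y\<close>, so in Group I only the lower bound -1 remains to distinguish Ia from
    Ib.\<close>
  show "x_bif A C R \<epsilon> < 1" using P_x_bif(1)[OF k2] y unfolding P by linarith
  have c: "cos (arccos y) = y" "0 < arccos y" "arccos y < pi"
    using y arccos_lt_bounded[of y] by auto
  have "cos \<theta> < y \<longleftrightarrow> arccos y < \<theta>" if "0 < \<theta>" "\<theta> < pi"
    using that c cos_mono_less_eq[of \<theta> "arccos y"] by simp
  then show "(\<exists>J. intermediate J \<theta>) \<longleftrightarrow> arccos ((\<epsilon> / R) / (1 - A / C)) < \<theta> \<and> \<theta> < pi"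
    unfolding ex_intermediate_iff P y_def[symmetric] using c by auto
qed

text \<open>The constant term \<open>\<epsilon> / R\<close> of \<open>P\<close> exceeds the modulus
  of its slope, so \<open>P\<close> is positive on all of [-1, 1].\<close>

lemma groupII_ex_intermediate:
  assumes "- (\<epsilon> / R) < A / C - 1" "A / C - 1 < \<epsilon> / R" "0 < \<theta>" "\<theta> < pi"
  shows "\<exists>J. intermediate J \<theta>"
proof -
  have "\<bar>(A / C - 1) * cos \<theta>\<bar> \<le> \<bar>A / C - 1\<bar> * 1"
    unfolding abs_mult by (intro mult_left_mono) auto
  also have "\<dots> < \<epsilon> / R" using assms(1,2) by (simp add: abs_if)
  finally have "P (cos \<theta>) > 0" unfolding P_def by linarith
  then show ?thesis using assms by (simp add: ex_intermediate_iff)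
qed

text \<open>Now 1 - A/C is negative, so \<open>P\<close> increases and is positive exactly to the
  right of its zero \<open>y\<close>, which lies in (-1, 0). Since A/C - 1 is positive,
  \<open>no_fold\<close> applies to every intermediate state.\<close>

lemma groupIII:
  assumes k: "A / C - 1 > \<epsilon> / R"
  shows "unstable J pi"
    and "arccos ((\<epsilon> / R) / (1 - A / C)) < \<theta> \<Longrightarrow> \<not> intermediate J \<theta>"
    and "\<not> bifurcation J \<theta>"
    and "intermediate J \<theta> \<Longrightarrow> stable J \<theta>"
proof -
  have "C * ((1 + \<epsilon> / R) - A / C) * (spin_pi C R \<epsilon> J)\<^sup>2 \<le> 0"
    using C k by (intro mult_nonpos_nonneg mult_nonneg_nonpos) auto
  also have "0 < m * g * \<epsilon> * (1 + \<epsilon> / R)\<^sup>2" using m g \<epsilon> e_pos by (intro mult_pos_pos) auto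
  finally show "unstable J pi" unfolding unstable_pi_iff stable_pi_iff by linarith
  define y where "y = (\<epsilon> / R) / (1 - A / C)"
  have kneg: "1 - A / C < 0" using k e_pos by linarith
  have y: "- 1 < y" "y < 0"
    unfolding y_def neg_less_divide_eq[OF kneg] using k divide_pos_neg[OF e_pos kneg] by simp_all
  have P: "P x > 0 \<longleftrightarrow> y < x" for x
  proof -
    have "P x = \<epsilon> / R - x * (1 - A / C)" by (simp add: P_def algebra_simps)
    then show ?thesis unfolding y_def neg_divide_less_eq[OF kneg] by linarith
  qed
  have c: "cos (arccos y) = y" "0 < arccos y" "arccos y < pi"
    using y arccos_lt_bounded[of y] by auto
  show "\<not> intermediate J \<theta>" if "arccos ((\<epsilon> / R) / (1 - A / C)) < \<theta>"
  proof
    assume i: "intermediate J \<theta>"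
    then have "cos \<theta> < cos (arccos y)"
      using that c by (intro cos_monotone_0_pi) (auto simp: intermediate_state_def y_def)
    then show False using intermediate_P_pos[OF i] c P by simp
  qed
  have "0 \<le> (\<epsilon> / R)\<^sup>2" by simp
  then have k2: "A / C - 1 \<ge> - (\<epsilon> / R)\<^sup>2" using k e_pos by linarith
  show "\<not> bifurcation J \<theta>" using no_fold(2)[OF k2] bifurcation_iff by blast
  show "intermediate J \<theta> \<Longrightarrow> stable J \<theta>" using no_fold(1)[OF k2] .
qed

lemma all_intermediate_unstable:
  assumes "A / C - 1 < - (\<epsilon> / R)\<^sup>2" "x_bif A C R \<epsilon> < - 1" "intermediate J \<theta>"
  shows "unstable J \<theta>"
  using assms(2) cos_ge_minus_one[of \<theta>]
  unfolding unstable_intermediate_iff[OF assms(3)] stable_intermediate_x_bif[OF assms(1,3)] by linarith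

lemma all_intermediate_stable:
  assumes "A / C - 1 < - (\<epsilon> / R)\<^sup>2" "x_bif A C R \<epsilon> > 1" "intermediate J \<theta>"
  shows "stable J \<theta>"
  using assms(2) cos_le_one[of \<theta>] unfolding stable_intermediate_x_bif[OF assms(1,3)] by linarith

end

theorem mainTheorem3:
  fixes m g A C R \<epsilon> \<mu> :: real
  assumes "m > 0" and "g > 0" and "A > 0" and "C > 0" and "R > 0" and "\<mu> > 0"
    and "0 < \<epsilon>" and "\<epsilon> < R"
  shows
    "let stable = stable_state m g A C R \<epsilon> \<mu>;
         unstable = unstable_state m g A C R \<epsilon> \<mu>;
         intermediate = intermediate_state m g A C R \<epsilon>;
         bifurcation = bifurcation_point m g A C R \<epsilon>;
         n0 = spin_0 C R \<epsilon>;
         npi = spin_pi C R \<epsilon>;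
         n1 = sqrt (m * g * \<epsilon> / (C * (A / C - (1 - \<epsilon> / R)))) * (1 - \<epsilon> / R);
         n2 = sqrt (m * g * \<epsilon> / (C * ((1 + \<epsilon> / R) - A / C))) * (1 + \<epsilon> / R);
         xb = x_bif A C R \<epsilon>;
         \<theta>b = arccos xb;
         \<theta>c = arccos ((\<epsilon> / R) / (1 - A / C))
     in
       \<comment> \<open>Group I\<close>
       (A / C - 1 < - (\<epsilon> / R) \<longrightarrow>
          (\<forall>J. stable J 0) \<and>
          (\<forall>J. (\<bar>npi J\<bar> > n2 \<longrightarrow> stable J pi) \<and> (\<not> \<bar>npi J\<bar> > n2 \<longrightarrow> unstable J pi)) \<and>
          (\<forall>\<theta>. (\<exists>J. intermediate J \<theta>) \<longleftrightarrow> \<theta>c < \<theta> \<and> \<theta> < pi) \<and>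
          (xb < -1 \<longrightarrow> (\<forall>J \<theta>. intermediate J \<theta> \<longrightarrow> unstable J \<theta>)) \<and>
          (xb > -1 \<longrightarrow>
             (\<exists>J. bifurcation J \<theta>b) \<and>
             (\<forall>J \<theta>. intermediate J \<theta> \<and> \<theta> > \<theta>b \<longrightarrow> stable J \<theta>) \<and>
             (\<forall>J \<theta>. intermediate J \<theta> \<and> \<theta> < \<theta>b \<longrightarrow> unstable J \<theta>))) \<and>
       \<comment> \<open>Group II\<close>
       (- (\<epsilon> / R) < A / C - 1 \<and> A / C - 1 < \<epsilon> / R \<longrightarrow>
          (\<forall>J. (\<bar>n0 J\<bar> < n1 \<longrightarrow> stable J 0) \<and> (\<bar>n0 J\<bar> > n1 \<longrightarrow> unstable J 0)) \<and>
          (\<forall>J. (\<bar>npi J\<bar> > n2 \<longrightarrow> stable J pi) \<and> (\<not> \<bar>npi J\<bar> > n2 \<longrightarrow> unstable J pi)) \<and>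
          (\<forall>\<theta>. 0 < \<theta> \<and> \<theta> < pi \<longrightarrow> (\<exists>J. intermediate J \<theta>)) \<and>
          (A / C - 1 < - (\<epsilon> / R)\<^sup>2 \<and> \<bar>xb\<bar> < 1 \<longrightarrow>
             (\<exists>J. bifurcation J \<theta>b) \<and>
             (\<forall>J \<theta>. intermediate J \<theta> \<and> \<theta> > \<theta>b \<longrightarrow> stable J \<theta>) \<and>
             (\<forall>J \<theta>. intermediate J \<theta> \<and> \<theta> < \<theta>b \<longrightarrow> unstable J \<theta>)) \<and>
          (A / C - 1 \<ge> - (\<epsilon> / R)\<^sup>2 \<or> (A / C - 1 < - (\<epsilon> / R)\<^sup>2 \<and> xb > 1) \<longrightarrow>
             (\<forall>J \<theta>. intermediate J \<theta> \<longrightarrow> stable J \<theta>)) \<and>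
          (A / C - 1 < - (\<epsilon> / R)\<^sup>2 \<and> xb < -1 \<longrightarrow>
             (\<forall>J \<theta>. intermediate J \<theta> \<longrightarrow> unstable J \<theta>))) \<and>
       \<comment> \<open>Group III\<close>
       (A / C - 1 > \<epsilon> / R \<longrightarrow>
          (\<forall>J. (\<bar>n0 J\<bar> < n1 \<longrightarrow> stable J 0) \<and> (\<bar>n0 J\<bar> > n1 \<longrightarrow> unstable J 0)) \<and>
          (\<forall>J. unstable J pi) \<and>
          (\<forall>J \<theta>. \<theta>c < \<theta> \<and> \<theta> < pi \<longrightarrow> \<not> intermediate J \<theta>) \<and>
          (\<forall>J \<theta>. \<not> bifurcation J \<theta>) \<and>
          (\<forall>J \<theta>. intermediate J \<theta> \<longrightarrow> stable J \<theta>)) \<and>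
       \<comment> \<open>Tipping\<close>
       (- (\<epsilon> / R) < A / C - 1 \<and> A / C - 1 < \<epsilon> / R \<longrightarrow>
          (\<forall>J. \<bar>n0 J\<bar> > max n1 (n2 * ((R + \<epsilon>) / (R - \<epsilon>))) \<longrightarrow> unstable J 0 \<and> stable J pi))"
proof -
  interpret tippe_top m g A C R \<epsilon> \<mu> by unfold_locales (use assms in auto)
  \<comment> \<open>Groups I and II share the threshold at pi, Groups II and III the one at 0;
    \<open>below\<close> and \<open>above\<close> let the outer groups use the shared
    lemmas.\<close>
  have below: "A / C - 1 < - (\<epsilon> / R) \<Longrightarrow> A / C - 1 < \<epsilon> / R" using e_pos by linarith
  have above: "A / C - 1 > \<epsilon> / R \<Longrightarrow> A / C - 1 > - (\<epsilon> / R)" using e_pos by linarith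
  have abs: "- 1 < x" "x < 1" if "\<bar>x\<bar> < 1" for x :: real using that by linarith+
  note intros = groupI(1,3,4) groupII_ex_intermediate groupIII(1)
    stable_0_spin stable_pi_spin tipping_spin bifurcation_structure no_fold(1)
    all_intermediate_stable all_intermediate_unstable below above abs
  show ?thesis
    unfolding Let_def max_less_iff_conj
    by (intro conjI impI allI; (elim conjE disjE)?;
      ((rule groupI(2) groupIII; assumption) | blast intro: intros))
qed

end
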